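(* A positive integer $n$ is quasi-practical if and only if $n$ is practical or $n$ is prime.
   Context: For $n\in\mathbb{N}$, $\sigma(n)$ is the sum of all positive divisors of $n$ and $s(n)=\sigma(n)-n$ is the sum of all proper positive divisors of $n$ (divisors different from $n$). A positive integer $n$ is practical if every integer $k$ with $1\le k\le\sigma(n)$ is a sum of distinct positive divisors of $n$. A positive integer $n$ is quasi-practical if every positive integer $k\le s(n)$ is a sum of distinct proper positive divisors of $n$. *)

theory Defs
  imports "HOL-Computational_Algebra.Primes"
begin

definition sigma :: "nat \<Rightarrow> nat" where
  "sigma n = \<Sum>{d. d dvd n}"

definition proper_divisors :: "nat \<Rightarrow> nat set" where
  "proper_divisors n = {d. d dvd n \<and> d \<noteq> n}"

(* The truncated subtraction is exact for n > 0, since n is one of its own divisors. *)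
definition aliquot_sum :: "nat \<Rightarrow> nat" where
  "aliquot_sum n = sigma n - n"

(* A sum of distinct divisors is the sum of the elements of a set of divisors. *)
definition practical :: "nat \<Rightarrow> bool" where
  "practical n \<longleftrightarrow> n > 0 \<and>
     (\<forall>k. 1 \<le> k \<and> k \<le> sigma n \<longrightarrow> (\<exists>D. D \<subseteq> {d. d dvd n} \<and> k = \<Sum>D))"

definition quasi_practical :: "nat \<Rightarrow> bool" where
  "quasi_practical n \<longleftrightarrow> n > 0 \<and>
     (\<forall>k. 1 \<le> k \<and> k \<le> aliquot_sum n \<longrightarrow>
        (\<exists>D. D \<subseteq> proper_divisors n \<and> k = \<Sum>D))"

end

theory Submission
  imports Defs
begin

text \<open>
  A finite set \<open>A\<close> of naturals represents every number up to its sum as soon as no element of \<open>A\<close>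
  exceeds the sum of the smaller ones by more than one. For practical \<open>n\<close> the divisors satisfy this
  condition (represent \<open>d - 1\<close>), and the condition passes to the proper divisors. Conversely, let
  \<open>n\<close> be quasi-practical, greater than one and not prime. Then the aliquot sum is at least 2, and
  representing 2 forces \<open>n\<close> to be even; representing \<open>n div 2 - 1\<close>, which does not use the divisor
  \<open>n div 2\<close>, shows that the aliquot sum is at least \<open>n - 1\<close>, so adding \<open>n\<close> to representations
  covers everything up to \<open>\<sigma>(n)\<close>.
\<close>

text \<open>Greedy choice by induction on the largest element \<open>m\<close>: if \<open>k\<close>
  exceeds the sum of the other elements, take \<open>m\<close> and represent \<open>k - m\<close> by
  the others.\<close>

lemma subset_sum_if_no_gaps:
  fixes A :: "nat set"
  assumes "finite A"
    and "\<And>a. a \<in> A \<Longrightarrow> a \<le> Suc (\<Sum>{b \<in> A. b < a})"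
    and "k \<le> \<Sum>A"
  shows "\<exists>D \<subseteq> A. k = \<Sum>D"
  using assms
proof (induction A arbitrary: k rule: finite_linorder_max_induct)
  case empty
  then show ?case by simp
next
  case (insert m A)
  have m: "m \<notin> A" using insert.hyps by auto
  have "{b \<in> insert m A. b < m} = A" using insert.hyps by auto
  then have le: "m \<le> Suc (\<Sum>A)" using insert.prems(1)[of m] by simp
  have "{b \<in> insert m A. b < a} = {b \<in> A. b < a}" if "a \<in> A" for a
    using insert.hyps that by auto
  then have gaps: "a \<le> Suc (\<Sum>{b \<in> A. b < a})" if "a \<in> A" for a
    using insert.prems(1)[of a] that by simp
  show ?case
  proof (cases "k \<le> \<Sum>A")
    case True
    then show ?thesis using insert.IH[OF gaps] by blast
  next
    case False
    have "k - m \<le> \<Sum>A" using insert.prems(2) insert.hyps m by simp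
    then obtain D where D: "D \<subseteq> A" "k - m = \<Sum>D" using insert.IH[OF gaps] by blast
    have "finite D" "m \<notin> D" using D m insert.hyps finite_subset by auto
    \<comment> \<open>\<open>False\<close> and \<open>le\<close> give \<open>m \<le> k\<close>, so
      the subtraction \<open>k - m\<close> is exact.\<close>
    then have "\<Sum>(insert m D) = k" using D(2) le False by simp
    then show ?thesis using D(1) by (intro exI[of _ "insert m D"]) auto
  qed
qed

lemma finite_proper_divisors: "n > 0 \<Longrightarrow> finite (proper_divisors n)"
  by (simp add: proper_divisors_def)

lemma divisors_eq_insert: "{d. d dvd n} = insert n (proper_divisors n)"
  by (auto simp: proper_divisors_def)

lemma self_notin_proper_divisors: "n \<notin> proper_divisors n"
  by (simp add: proper_divisors_def)

lemma sigma_eq: "n > 0 \<Longrightarrow> sigma n = n + \<Sum>(proper_divisors n)"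
  by (simp add: sigma_def divisors_eq_insert finite_proper_divisors self_notin_proper_divisors)

lemma aliquot_sum_eq: "n > 0 \<Longrightarrow> aliquot_sum n = \<Sum>(proper_divisors n)"
  by (simp add: aliquot_sum_def sigma_eq)

text \<open>Divisors that sum to \<open>d - 1\<close> are all smaller than \<open>d\<close>, so the
  divisors below \<open>d\<close> sum to at least \<open>d - 1\<close>.\<close>

lemma practical_divisor_le:
  assumes "practical n" "d dvd n"
  shows "d \<le> Suc (\<Sum>{b. b dvd n \<and> b < d})"
proof (cases "d \<le> 1")
  case False
  have n: "n > 0" using assms by (simp add: practical_def)
  have "d - 1 \<le> sigma n" using dvd_imp_le[OF assms(2) n] sigma_eq[OF n] by simp
  moreover have "1 \<le> d - 1" using False by simp
  ultimately obtain D where D: "D \<subseteq> {d. d dvd n}" "d - 1 = \<Sum>D"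
    using assms(1) unfolding practical_def by blast
  have fin: "finite D" using D(1) n finite_subset by fastforce
  have "b < d" if "b \<in> D" for b
    using member_le_sum[OF that, of "\<lambda>x. x"] fin D(2) False by simp
  then have "D \<subseteq> {b. b dvd n \<and> b < d}" using D(1) by auto
  then have "\<Sum>D \<le> \<Sum>{b. b dvd n \<and> b < d}" by (intro sum_mono2) (use n in auto)
  then show ?thesis using D(2) by simp
qed simp

lemma practical_imp_quasi_practical:
  assumes "practical n"
  shows "quasi_practical n"
proof -
  have n: "n > 0" using assms by (simp add: practical_def)
  have "a \<le> Suc (\<Sum>{b \<in> proper_divisors n. b < a})" if "a \<in> proper_divisors n" for a
  proof -
    have a: "a dvd n" "a \<le> n" using that n by (auto simp: proper_divisors_def dvd_imp_le)
    \<comment> \<open>As \<open>a \<le> n\<close>, the divisor \<open>n\<close> is never among those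
      below \<open>a\<close>.\<close>
    then have "{b \<in> proper_divisors n. b < a} = {b. b dvd n \<and> b < a}"
      by (auto simp: proper_divisors_def)
    then show ?thesis using practical_divisor_le[OF assms a(1)] by simp
  qed
  from subset_sum_if_no_gaps[OF finite_proper_divisors[OF n] this]
  show ?thesis using n by (simp add: quasi_practical_def aliquot_sum_eq)
qed

lemma prime_imp_quasi_practical:
  fixes p :: nat
  assumes "prime p"
  shows "quasi_practical p"
proof -
  have p: "p > 1" "\<And>d. d dvd p \<Longrightarrow> d = 1 \<or> d = p"
    using assms by (auto simp: prime_nat_iff)
  then have pd: "proper_divisors p = {1}" by (auto simp: proper_divisors_def)
  then have "aliquot_sum p = 1" using p(1) by (simp add: aliquot_sum_eq)
  then have "k = \<Sum>(proper_divisors p)" if "1 \<le> k" "k \<le> aliquot_sum p" for k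
    using that pd by simp
  then show ?thesis using p(1) unfolding quasi_practical_def by auto
qed

text \<open>The only way to write 2 as a sum of distinct naturals uses 2 itself, up to a harmless
  0.\<close>

lemma quasi_practical_even:
  assumes "quasi_practical n" "n > 1" "\<not> prime n"
  shows "even n"
proof -
  have fin: "finite (proper_divisors n)" using assms finite_proper_divisors by simp
  \<comment> \<open>With 1, this further proper divisor lifts the aliquot sum to at least 2, so that
    2 must be represented.\<close>
  obtain p where p: "p dvd n" "p \<noteq> 1" "p \<noteq> n"
    using assms(2,3) by (auto simp: prime_nat_iff)
  have "{1, p} \<subseteq> proper_divisors n" using p assms(2) by (auto simp: proper_divisors_def)
  from sum_mono2[OF fin this, of "\<lambda>x. x"]
  have "1 + p \<le> aliquot_sum n" using p assms(2) by (simp add: aliquot_sum_eq)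
  moreover have "p > 0" using p assms(2) by (auto intro: Nat.gr0I)
  ultimately have "1 \<le> (2::nat)" "2 \<le> aliquot_sum n" by auto
  then obtain D where D: "D \<subseteq> proper_divisors n" "2 = \<Sum>D"
    using assms(1) unfolding quasi_practical_def by blast
  have finD: "finite D" using D(1) fin finite_subset by blast
  have "x \<in> {0, 1, 2}" if "x \<in> D" for x
    using member_le_sum[OF that, of "\<lambda>x. x"] finD D(2) by auto
  have "2 \<in> D"
  proof (rule ccontr)
    assume "2 \<notin> D"
    then have "D \<subseteq> {0, 1}" using \<open>\<And>x. x \<in> D \<Longrightarrow> x \<in> {0, 1, 2}\<close> by blast
    from sum_mono2[OF _ this, of "\<lambda>x. x"] show False using D(2) by simp
  qed
  then show ?thesis using D(1) by (auto simp: proper_divisors_def)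
qed

lemma quasi_practical_aliquot_sum_ge:
  assumes "quasi_practical n" "n > 1" "\<not> prime n"
  shows "n - 1 \<le> aliquot_sum n"
proof -
  obtain m where m: "n = 2 * m" using quasi_practical_even[OF assms] by (auto elim: evenE)
  \<comment> \<open>This makes \<open>m - 1\<close> positive, as \<open>quasi_practical\<close>
    requires of the number to be represented.\<close>
  have m2: "m \<ge> 2"
  proof (rule ccontr)
    assume "\<not> m \<ge> 2"
    then have "n = 2" using m assms(2) by simp
    then show False using assms(3) by simp
  qed
  have fin: "finite (proper_divisors n)" using assms finite_proper_divisors by simp
  have md: "m \<in> proper_divisors n" using m m2 by (simp add: proper_divisors_def)
  have s: "aliquot_sum n = \<Sum>(proper_divisors n)" using assms(2) by (simp add: aliquot_sum_eq)
  then have "m - 1 \<le> aliquot_sum n" using member_le_sum[OF md, of "\<lambda>x. x"] fin by simp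
  moreover have "1 \<le> m - 1" using m2 by simp
  ultimately obtain D where D: "D \<subseteq> proper_divisors n" "m - 1 = \<Sum>D"
    using assms(1) unfolding quasi_practical_def by blast
  have finD: "finite D" using D(1) fin finite_subset by blast
  \<comment> \<open>\<open>m\<close> exceeds the whole sum of \<open>D\<close>; adding it yields
    \<open>(m - 1) + m = n - 1\<close>.\<close>
  have "m \<notin> D" using member_le_sum[of m D "\<lambda>x. x"] finD D(2) m2 by auto
  then have "\<Sum>(insert m D) = n - 1" using finD D(2) m m2 by simp
  moreover have "\<Sum>(insert m D) \<le> aliquot_sum n"
    unfolding s by (intro sum_mono2) (use fin md D in auto)
  ultimately show ?thesis by simp
qed

lemma quasi_practical_imp_practical:
  assumes "quasi_practical n" "\<not> prime n"
  shows "practical n"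
proof -
  have n: "n > 0" using assms by (simp add: quasi_practical_def)
  have ge: "n - 1 \<le> aliquot_sum n"
    using quasi_practical_aliquot_sum_ge[OF assms(1) _ assms(2)] by (cases "n > 1") auto
  \<comment> \<open>Zero is included because \<open>k - n\<close> below vanishes when
    \<open>k = n\<close>.\<close>
  have rep: "\<exists>D \<subseteq> proper_divisors n. k = \<Sum>D" if "k \<le> aliquot_sum n" for k
  proof (cases "k = 0")
    case True
    then show ?thesis by (intro exI[of _ "{}"]) simp
  next
    case False
    then show ?thesis using assms(1) that by (simp add: quasi_practical_def)
  qed
  have "\<exists>D \<subseteq> {d. d dvd n}. k = \<Sum>D" if k: "k \<le> sigma n" for k
  proof (cases "k \<le> aliquot_sum n")
    case True
    then obtain D where "D \<subseteq> proper_divisors n" "k = \<Sum>D" using rep by blast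
    then show ?thesis by (intro exI[of _ D]) (auto simp: proper_divisors_def)
  next
    case False
    have "k - n \<le> aliquot_sum n" using k by (simp add: aliquot_sum_def)
    then obtain D where D: "D \<subseteq> proper_divisors n" "k - n = \<Sum>D" using rep by blast
    have "finite D" "n \<notin> D"
      using finite_subset[OF D(1) finite_proper_divisors[OF n]] D(1) self_notin_proper_divisors
      by auto
    \<comment> \<open>Here \<open>k > aliquot_sum n \<ge> n - 1\<close>, hence
      \<open>k \<ge> n\<close> and \<open>k - n\<close> is exact.\<close>
    then have "k = \<Sum>(insert n D)" using D(2) False ge by simp
    moreover have "insert n D \<subseteq> {d. d dvd n}" using D(1) by (auto simp: proper_divisors_def)
    ultimately show ?thesis by blast
  qed
  then show ?thesis using n by (simp add: practical_def)
qed

theorem theorem2p9: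
  fixes n :: nat
  assumes "n > 0"
  shows "quasi_practical n \<longleftrightarrow> practical n \<or> prime n"
  using practical_imp_quasi_practical prime_imp_quasi_practical quasi_practical_imp_practical
  by blast

end
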